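(* Let $S$ be an $F$-inverse monoid with $S\neq E(S)$. Then the only Rees $F$-congruence on $S$ is the universal congruence $\Delta_S=S\times S$.
   Context: For an inverse semigroup $S$, $E(S)$ is its set of idempotents, $\leq$ is the natural partial order ($s\leq t$ iff $s=et$ for some $e\in E(S)$), and $\sigma$ is the minimum group congruence ($s\mathrel{\sigma}t$ iff $es=et$ for some $e\in E(S)$). $S$ is $F$-inverse if every $\sigma$-class has a maximum element with respect to $\leq$; such an $S$ is automatically a monoid. For $a\in S$, $a^{\mathfrak m}$ denotes the maximum element of the $\sigma$-class of $a$. An $F$-congruence on an $F$-inverse monoid $S$ is a (two-sided, multiplicative) congruence $\rho$ such that $a\mathrel{\rho}b$ implies $a^{\mathfrak m}\mathrel{\rho}b^{\mathfrak m}$ for all $a,b\in S$. For a (nonempty, two-sided) ideal $I$ of $S$, the Rees congruence $\rho_I$ is defined by: $a\mathrel{\rho_I}b$ iff $a=b$ or $a,b\in I$. A Rees $F$-congruence is a Rees congruence $\rho_I$ (for some ideal $I$) which is an $F$-congruence. *)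

theory Defs
  imports Main
begin

text \<open>A semigroup is given by a carrier set \<open>S\<close> and a binary operation \<open>f\<close>, of which only the
  values on \<open>S\<close> matter. No identity element is assumed: its existence follows from the
  \<open>F\<close>-inverse condition.\<close>

locale inverse_semigroup =
  fixes S :: "'a set" and f :: "'a \<Rightarrow> 'a \<Rightarrow> 'a"  (infixl \<open>\<cdot>\<close> 70)
  assumes nonempty: "S \<noteq> {}"
    and closed: "a \<in> S \<Longrightarrow> b \<in> S \<Longrightarrow> a \<cdot> b \<in> S"
    and assoc: "a \<in> S \<Longrightarrow> b \<in> S \<Longrightarrow> c \<in> S \<Longrightarrow> (a \<cdot> b) \<cdot> c = a \<cdot> (b \<cdot> c)"
    and unique_inverse: "a \<in> S \<Longrightarrow> \<exists>!b. b \<in> S \<and> a \<cdot> b \<cdot> a = a \<and> b \<cdot> a \<cdot> b = b"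

definition idempotents :: "'a set \<Rightarrow> ('a \<Rightarrow> 'a \<Rightarrow> 'a) \<Rightarrow> 'a set" where
  "idempotents S f = {e \<in> S. f e e = e}"

definition nat_le :: "'a set \<Rightarrow> ('a \<Rightarrow> 'a \<Rightarrow> 'a) \<Rightarrow> 'a \<Rightarrow> 'a \<Rightarrow> bool" where
  "nat_le S f s t \<longleftrightarrow> s \<in> S \<and> t \<in> S \<and> (\<exists>e \<in> idempotents S f. s = f e t)"

definition min_group_cong :: "'a set \<Rightarrow> ('a \<Rightarrow> 'a \<Rightarrow> 'a) \<Rightarrow> 'a rel" where
  "min_group_cong S f = {(s, t) \<in> S \<times> S. \<exists>e \<in> idempotents S f. f e s = f e t}"

definition is_class_max :: "'a set \<Rightarrow> ('a \<Rightarrow> 'a \<Rightarrow> 'a) \<Rightarrow> 'a \<Rightarrow> 'a \<Rightarrow> bool" where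
  "is_class_max S f a m \<longleftrightarrow>
     m \<in> min_group_cong S f `` {a} \<and> (\<forall>x \<in> min_group_cong S f `` {a}. nat_le S f x m)"

locale F_inverse_monoid = inverse_semigroup +
  assumes ex_class_max: "a \<in> S \<Longrightarrow> \<exists>m. is_class_max S f a m"

definition class_max :: "'a set \<Rightarrow> ('a \<Rightarrow> 'a \<Rightarrow> 'a) \<Rightarrow> 'a \<Rightarrow> 'a" where
  "class_max S f a = (THE m. is_class_max S f a m)"

definition semigroup_congruence :: "'a set \<Rightarrow> ('a \<Rightarrow> 'a \<Rightarrow> 'a) \<Rightarrow> 'a rel \<Rightarrow> bool" where
  "semigroup_congruence S f \<rho> \<longleftrightarrow> equiv S \<rho> \<and>
     (\<forall>(a, b) \<in> \<rho>. \<forall>c \<in> S. (f c a, f c b) \<in> \<rho> \<and> (f a c, f b c) \<in> \<rho>)"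

definition F_congruence :: "'a set \<Rightarrow> ('a \<Rightarrow> 'a \<Rightarrow> 'a) \<Rightarrow> 'a rel \<Rightarrow> bool" where
  "F_congruence S f \<rho> \<longleftrightarrow> semigroup_congruence S f \<rho> \<and>
     (\<forall>(a, b) \<in> \<rho>. (class_max S f a, class_max S f b) \<in> \<rho>)"

definition semigroup_ideal :: "'a set \<Rightarrow> ('a \<Rightarrow> 'a \<Rightarrow> 'a) \<Rightarrow> 'a set \<Rightarrow> bool" where
  "semigroup_ideal S f I \<longleftrightarrow> I \<noteq> {} \<and> I \<subseteq> S \<and> (\<forall>x \<in> I. \<forall>s \<in> S. f s x \<in> I \<and> f x s \<in> I)"

definition rees_congruence :: "'a set \<Rightarrow> 'a set \<Rightarrow> 'a rel" where
  "rees_congruence S I = {(a, b) \<in> S \<times> S. a = b \<or> (a \<in> I \<and> b \<in> I)}"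

definition rees_F_congruence :: "'a set \<Rightarrow> ('a \<Rightarrow> 'a \<Rightarrow> 'a) \<Rightarrow> 'a rel \<Rightarrow> bool" where
  "rees_F_congruence S f \<rho> \<longleftrightarrow>
     (\<exists>I. semigroup_ideal S f I \<and> \<rho> = rees_congruence S I) \<and> F_congruence S f \<rho>"

end

theory Submission
  imports Defs
begin

text \<open>An ideal \<open>I\<close> of an inverse semigroup contains an idempotent \<open>e\<close>, namely \<open>x x\<inverse>\<close> for any
  \<open>x \<in> I\<close>. If \<open>s\<close> is an element outside \<open>E(S)\<close>, then \<open>e\<close> and \<open>e s\<close> both lie in \<open>I\<close>, so an
  \<open>F\<close>-congruence of the form \<open>\<rho>\<^sub>I\<close> relates the maximum elements of their \<open>\<sigma>\<close>-classes. The
  \<open>\<sigma>\<close>-class of \<open>e\<close> contains all idempotents and its maximum is the identity \<open>1\<close>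
  (lemma \<open>class_max_idempotent_is_identity\<close>), while the class of \<open>e s\<close> contains \<open>s\<close>.
  The two maxima are distinct: otherwise \<open>s \<le> 1\<close>, and everything below \<open>1\<close> is idempotent. As
  \<open>\<rho>\<^sub>I\<close> identifies distinct elements only inside \<open>I\<close>, the identity lies in \<open>I\<close>, that is, \<open>I = S\<close>.\<close>

context inverse_semigroup
begin

lemma idempotentsD: "e \<in> idempotents S f \<Longrightarrow> e \<in> S \<and> e \<cdot> e = e"
  by (simp add: idempotents_def)

lemma inverse_unique:
  assumes "a \<in> S" "b \<in> S" "a \<cdot> b \<cdot> a = a" "b \<cdot> a \<cdot> b = b"
    and "c \<in> S" "a \<cdot> c \<cdot> a = a" "c \<cdot> a \<cdot> c = c"
  shows "b = c"
  using unique_inverse[OF assms(1)] assms by blast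

text \<open>The inverse \<open>x\<close> of \<open>e g\<close> equals \<open>g x e\<close>, since the latter is also an inverse of \<open>e g\<close>. This
  makes \<open>x\<close> idempotent, hence its own inverse, and therefore \<open>x = e g\<close>.\<close>

lemma idempotents_mult_closed:
  assumes e: "e \<in> idempotents S f" and g: "g \<in> idempotents S f"
  shows "e \<cdot> g \<in> idempotents S f"
proof -
  have eS: "e \<in> S" and ee: "e \<cdot> e = e" and gS: "g \<in> S" and gg: "g \<cdot> g = g"
    using e g by (auto dest: idempotentsD)
  have eg: "e \<cdot> g \<in> S" using eS gS closed by blast
  obtain x where x: "x \<in> S" "e \<cdot> g \<cdot> x \<cdot> (e \<cdot> g) = e \<cdot> g" "x \<cdot> (e \<cdot> g) \<cdot> x = x"
    using unique_inverse[OF eg] by blast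
  have ee': "e \<cdot> (e \<cdot> y) = e \<cdot> y" and gg': "g \<cdot> (g \<cdot> y) = g \<cdot> y" if "y \<in> S" for y
    using assoc[of e e y] assoc[of g g y] eS gS ee gg that by simp_all
  note norm = assoc closed eS gS ee gg ee' gg'
  have x2: "e \<cdot> (g \<cdot> (x \<cdot> (e \<cdot> g))) = e \<cdot> g" and x3: "x \<cdot> (e \<cdot> (g \<cdot> x)) = x"
    using x by (simp_all add: norm)
  have x3': "x \<cdot> (e \<cdot> (g \<cdot> (x \<cdot> y))) = x \<cdot> y" if "y \<in> S" for y
    using arg_cong[OF x3, of "\<lambda>z. z \<cdot> y"] that x(1) by (simp add: norm)
  have "x = g \<cdot> x \<cdot> e"
    by (rule inverse_unique[OF eg]) (use x in \<open>simp_all add: norm x2 x3 x3'\<close>)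
  then have gxe: "g \<cdot> (x \<cdot> e) = x" using x(1) by (simp add: norm)
  have "x \<cdot> x = g \<cdot> (x \<cdot> e) \<cdot> (g \<cdot> (x \<cdot> e))" by (simp only: gxe)
  also have "\<dots> = g \<cdot> (x \<cdot> e)" using x(1) by (simp add: norm x3')
  finally have xx: "x \<cdot> x = x" by (simp only: gxe)
  have "e \<cdot> g = x"
    by (rule inverse_unique[OF x(1)]) (use x eg xx in simp_all)
  then show ?thesis using x(1) xx by (simp add: idempotents_def)
qed

text \<open>Both \<open>e g\<close> and \<open>g e\<close> are inverses of \<open>e g\<close>.\<close>

lemma idempotents_commute:
  assumes e: "e \<in> idempotents S f" and g: "g \<in> idempotents S f"
  shows "e \<cdot> g = g \<cdot> e"
proof -
  have eS: "e \<in> S" and ee: "e \<cdot> e = e" and gS: "g \<in> S" and gg: "g \<cdot> g = g"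
    using e g by (auto dest: idempotentsD)
  have ee': "e \<cdot> (e \<cdot> y) = e \<cdot> y" and gg': "g \<cdot> (g \<cdot> y) = g \<cdot> y" if "y \<in> S" for y
    using assoc[of e e y] assoc[of g g y] eS gS ee gg that by simp_all
  have "(e \<cdot> g) \<cdot> (e \<cdot> g) = e \<cdot> g" "(g \<cdot> e) \<cdot> (g \<cdot> e) = g \<cdot> e"
    using idempotents_mult_closed[OF e g] idempotents_mult_closed[OF g e]
    by (auto dest: idempotentsD)
  then have idem: "e \<cdot> (g \<cdot> (e \<cdot> g)) = e \<cdot> g" "g \<cdot> (e \<cdot> (g \<cdot> e)) = g \<cdot> e"
    using eS gS by (simp_all add: assoc closed)
  show ?thesis
    by (rule inverse_unique[of "e \<cdot> g"])
      (use eS gS in \<open>simp_all add: assoc closed ee gg ee' gg' idem\<close>)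
qed

lemma mult_inverse_idempotent:
  assumes "a \<in> S" "b \<in> S" "a \<cdot> b \<cdot> a = a"
  shows "a \<cdot> b \<in> idempotents S f"
proof -
  have "(a \<cdot> b) \<cdot> (a \<cdot> b) = (a \<cdot> b \<cdot> a) \<cdot> b"
    using assoc[of "a \<cdot> b" a b] assms(1,2) closed by simp
  then show ?thesis using assms by (simp add: idempotents_def closed)
qed

lemma nat_le_antisym:
  assumes "nat_le S f s t" "nat_le S f t s"
  shows "s = t"
proof -
  obtain e g where st: "s \<in> S" "t \<in> S" and e: "e \<in> idempotents S f" "s = e \<cdot> t"
    and g: "g \<in> idempotents S f" "t = g \<cdot> s"
    using assms unfolding nat_le_def by blast
  have S: "e \<in> S" "g \<in> S" "e \<cdot> e = e" using e(1) g(1) by (auto dest: idempotentsD)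
  have es: "e \<cdot> s = s" using S st assoc[of e e t] by (simp add: e(2)[symmetric])
  have "t = g \<cdot> (e \<cdot> s)" unfolding es by (fact g(2))
  also have "\<dots> = e \<cdot> (g \<cdot> s)"
    using assoc[of g e s] assoc[of e g s] idempotents_commute[OF e(1) g(1)] S st by metis
  also have "\<dots> = s" by (simp only: g(2)[symmetric] e(2)[symmetric])
  finally show ?thesis by simp
qed

lemma class_max_eqI: "is_class_max S f a m \<Longrightarrow> class_max S f a = m"
  unfolding class_max_def
  by (rule the_equality) (auto simp: is_class_max_def intro!: nat_le_antisym)

end

context F_inverse_monoid
begin

lemma is_class_max_class_max: "a \<in> S \<Longrightarrow> is_class_max S f a (class_max S f a)"
  using ex_class_max class_max_eqI by metis

lemma class_max_closed: "a \<in> S \<Longrightarrow> class_max S f a \<in> S"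
  using is_class_max_class_max by (fastforce simp: is_class_max_def min_group_cong_def)

text \<open>All idempotents are \<open>\<sigma>\<close>-related, as \<open>(e g) e = e g = (e g) g\<close>.\<close>

lemma idempotent_le_class_max:
  assumes e: "e \<in> idempotents S f" and g: "g \<in> idempotents S f"
  shows "nat_le S f g (class_max S f e)"
proof -
  have S: "e \<in> S" "g \<in> S" "e \<cdot> e = e" "g \<cdot> g = g" using e g by (auto dest: idempotentsD)
  have "(e \<cdot> g) \<cdot> e = (e \<cdot> g) \<cdot> g"
    using S assoc[of e g g] assoc[of e e g] assoc[of e g e] idempotents_commute[OF e g] by simp
  then have "(e, g) \<in> min_group_cong S f"
    using S idempotents_mult_closed[OF e g] by (auto simp: min_group_cong_def)
  then show ?thesis
    using is_class_max_class_max[OF S(1)] by (auto simp: is_class_max_def)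
qed

lemma class_max_idempotent:
  assumes e: "e \<in> idempotents S f"
  shows "class_max S f e \<in> idempotents S f"
proof -
  define u where "u = class_max S f e"
  have u: "u \<in> S" unfolding u_def using class_max_closed e by (blast dest: idempotentsD)
  obtain v where v: "v \<in> S" "u \<cdot> v \<cdot> u = u" using unique_inverse[OF u] by blast
  define a where "a = u \<cdot> v"
  have a: "a \<in> idempotents S f" unfolding a_def using mult_inverse_idempotent u v by blast
  \<comment> \<open>The idempotent \<open>u u\<inverse>\<close> lies below \<open>u\<close> and acts as a left identity on \<open>u\<close>; an element
    below \<open>u\<close> with this property must be \<open>u\<close> itself.\<close>
  obtain h where h: "h \<in> idempotents S f" "a = h \<cdot> u"
    using idempotent_le_class_max[OF e a] by (auto simp: nat_le_def u_def)
  have S: "a \<in> S" "h \<in> S" "h \<cdot> h = h" using a h(1) by (auto dest: idempotentsD)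
  have au: "a \<cdot> u = u" using v by (simp add: a_def)
  have ha: "h \<cdot> a = a" unfolding h(2) using assoc[of h h u] S u by simp
  have "u = (h \<cdot> a) \<cdot> u" using au ha by simp
  also have "\<dots> = a" using assoc[of h a u] S u by (simp add: au h(2)[symmetric])
  finally show ?thesis using a by (simp add: u_def)
qed

text \<open>Every idempotent is below \<open>u = class_max S f e\<close>, so \<open>u\<close> fixes the idempotent
  \<open>x x\<inverse>\<close> and with it \<open>x = x x\<inverse> x\<close>.\<close>

lemma class_max_idempotent_is_identity:
  assumes e: "e \<in> idempotents S f" and x: "x \<in> S"
  shows "class_max S f e \<cdot> x = x"
proof -
  define u where "u = class_max S f e"
  have u: "u \<in> idempotents S f" unfolding u_def using class_max_idempotent[OF e] .
  obtain y where y: "y \<in> S" "x \<cdot> y \<cdot> x = x" using unique_inverse[OF x] by blast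
  define b where "b = x \<cdot> y"
  have b: "b \<in> idempotents S f" unfolding b_def using mult_inverse_idempotent x y by blast
  obtain h where h: "h \<in> idempotents S f" "b = h \<cdot> u"
    using idempotent_le_class_max[OF e b] by (auto simp: nat_le_def u_def)
  have S: "u \<in> S" "u \<cdot> u = u" "h \<in> S" "b \<in> S" using u h(1) b by (auto dest: idempotentsD)
  have "b \<cdot> u = b" unfolding h(2) using S by (simp add: assoc)
  then have ub: "u \<cdot> b = b" using idempotents_commute[OF u b] by simp
  have bx: "b \<cdot> x = x" using y by (simp add: b_def)
  have "u \<cdot> x = (u \<cdot> b) \<cdot> x" using assoc[of u b x] S x bx by simp
  also have "\<dots> = x" using ub bx by simp
  finally show ?thesis by (simp add: u_def)
qed

text \<open>The witness for \<open>e s \<sigma> s\<close> is \<open>e\<close> itself, as \<open>e (e s) = e s\<close>.\<close>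

lemma below_class_max_mult_idempotent:
  assumes e: "e \<in> idempotents S f" and s: "s \<in> S"
  shows "nat_le S f s (class_max S f (e \<cdot> s))"
proof -
  have S: "e \<in> S" "e \<cdot> e = e" "e \<cdot> s \<in> S" using e s by (auto dest: idempotentsD intro: closed)
  have "e \<cdot> (e \<cdot> s) = e \<cdot> s" using assoc[of e e s] S s by simp
  then have "(e \<cdot> s, s) \<in> min_group_cong S f"
    using e s S by (auto simp: min_group_cong_def)
  then show ?thesis
    using is_class_max_class_max[OF S(3)] by (auto simp: is_class_max_def)
qed

lemma ideal_contains_idempotent:
  assumes "semigroup_ideal S f I"
  shows "\<exists>e \<in> I. e \<in> idempotents S f"
proof -
  obtain x where x: "x \<in> I" "x \<in> S" using assms by (auto simp: semigroup_ideal_def)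
  obtain y where y: "y \<in> S" "x \<cdot> y \<cdot> x = x" using unique_inverse[OF x(2)] by blast
  have "x \<cdot> y \<in> I" using assms x y by (simp add: semigroup_ideal_def)
  then show ?thesis using mult_inverse_idempotent x y by blast
qed

lemma rees_F_congruence_ideal_eq_carrier:
  assumes I: "semigroup_ideal S f I" and F: "F_congruence S f (rees_congruence S I)"
    and s: "s \<in> S" "s \<notin> idempotents S f"
  shows "I = S"
proof -
  obtain e where e: "e \<in> I" "e \<in> idempotents S f" using ideal_contains_idempotent[OF I] by blast
  define u where "u = class_max S f e"
  define m where "m = class_max S f (e \<cdot> s)"
  have "(e, e \<cdot> s) \<in> rees_congruence S I"
    using I e s by (auto simp: rees_congruence_def semigroup_ideal_def)
  then have um: "(u, m) \<in> rees_congruence S I"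
    using F unfolding F_congruence_def u_def m_def by blast
  have "u \<noteq> m"
  proof
    assume "u = m"
    then obtain h where "h \<in> idempotents S f" "s = h \<cdot> u"
      using below_class_max_mult_idempotent[OF e(2) s(1)] by (auto simp: nat_le_def m_def)
    then have "s \<in> idempotents S f"
      using idempotents_mult_closed class_max_idempotent[OF e(2)] by (simp add: u_def)
    then show False using s(2) by blast
  qed
  then have "u \<in> I" using um by (auto simp: rees_congruence_def)
  then have "x \<in> I" if "x \<in> S" for x
    using I that class_max_idempotent_is_identity[OF e(2) that]
    by (metis semigroup_ideal_def u_def)
  then show ?thesis using I by (auto simp: semigroup_ideal_def)
qed

lemma rees_F_congruence_universal: "rees_F_congruence S f (S \<times> S)"
proof -
  have "semigroup_ideal S f S" using nonempty closed by (auto simp: semigroup_ideal_def)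
  moreover have "S \<times> S = rees_congruence S S" by (auto simp: rees_congruence_def)
  moreover have "equiv S (S \<times> S)"
    by (auto simp: equiv_def refl_on_def sym_def trans_def)
  ultimately show ?thesis
    by (auto simp: rees_F_congruence_def F_congruence_def semigroup_congruence_def
        intro: closed class_max_closed)
qed

end

theorem proposition4p2:
  fixes S :: "'a set" and f :: "'a \<Rightarrow> 'a \<Rightarrow> 'a"
  assumes "F_inverse_monoid S f"
    and "S \<noteq> idempotents S f"
  shows "{\<rho>. rees_F_congruence S f \<rho>} = {S \<times> S}"
proof -
  interpret F_inverse_monoid S f by (fact assms(1))
  obtain s where s: "s \<in> S" "s \<notin> idempotents S f"
    using assms(2) by (auto simp: idempotents_def)
  have "\<rho> = S \<times> S" if \<rho>: "rees_F_congruence S f \<rho>" for \<rho>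
  proof -
    obtain I where I: "semigroup_ideal S f I" "\<rho> = rees_congruence S I" "F_congruence S f \<rho>"
      using \<rho> by (auto simp: rees_F_congruence_def)
    then have "I = S" using rees_F_congruence_ideal_eq_carrier s by blast
    then show ?thesis using I(2) by (auto simp: rees_congruence_def)
  qed
  then show ?thesis using rees_F_congruence_universal by blast
qed

end
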